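(* Let $G$ be a finite group with set of irreducible complex characters $\operatorname{Irr}(G)=\{\chi_1,\ldots,\chi_r\}$. The following are equivalent: (1) $G$ is almost monomial. (2) There exists $1\leq t\leq r-1$ such that $L_t(G)\geq N_{r,t}$. (3) $L_{r-1}(G)=r$.
   Context: All characters are complex characters of finite groups, and $r=|\operatorname{Irr}(G)|$. A linear character is a character of degree $1$. For $H\leqslant G$ and a character $\theta$ of $H$, $\theta^G$ denotes the character of $G$ induced by $\theta$. For a character $\chi$ of $G$, its set of constituents is $\operatorname{Cons}(\chi):=\{\phi\in\operatorname{Irr}(G) : \langle \phi,\chi\rangle>0\}$. A finite group $G$ is called almost monomial if for any $\chi\neq\phi\in\operatorname{Irr}(G)$ there exist a subgroup $H\leqslant G$ and a linear character $\lambda$ of $H$ such that $\chi\in\operatorname{Cons}(\lambda^G)$ and $\phi\notin\operatorname{Cons}(\lambda^G)$. A character of $G$ is called monomial if it equals $\lambda^G$ for some subgroup $H\leqslant G$ and some linear character $\lambda$ of $H$. Let $\operatorname{M}(G)$ be the subsemigroup, under addition, of the set of characters of $G$ generated by the monomial characters, i.e. $\psi\in \operatorname{M}(G)$ if there exist subgroups $H_1,\ldots,H_k$ of $G$ and linear characters $\lambda_i$ of $H_i$ ($1\leq i\leq k$) such that $\psi=\lambda_1^G+\cdots+\lambda_k^G$. For $1\leq t\leq r$, define $$L_t(G):=\left|\{\operatorname{Cons}(\chi) : \chi\in \operatorname{M}(G)\text{ and }|\operatorname{Cons}(\chi)|=t\}\right|.$$ For $1\leq t\leq r-1$, define $$N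_{r,t}:=\binom{r}{t}-\binom{r-2}{t-1}+1.$$
   Formalization: The statement assumes r ≠ 1, i.e. it excludes the trivial group, for which (1) holds vacuously, (2) fails because there is no t with 1 ≤ t ≤ 0, and L_{r-1}(G) = L_0(G) in (3) is not defined. *)

theory Defs
  imports "Jordan_Normal_Form.VS_Connect"
begin

(* Class functions and characters are total functions 'a \<Rightarrow> complex that vanish outside the
   carrier of their group. So each one is determined by its values on the group, and sums may be
   taken pointwise. *)

abbreviation general_linear_group :: "nat \<Rightarrow> complex mat monoid" where
  "general_linear_group n \<equiv> units_of (ring_mat TYPE(complex) n ())"

definition representation :: "('a, 'b) monoid_scheme \<Rightarrow> nat \<Rightarrow> ('a \<Rightarrow> complex mat) \<Rightarrow> bool" where
  "representation G n \<rho> \<longleftrightarrow> 1 \<le> n \<and> \<rho> \<in> hom G (general_linear_group n)"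

definition irreducible_representation ::
    "('a, 'b) monoid_scheme \<Rightarrow> nat \<Rightarrow> ('a \<Rightarrow> complex mat) \<Rightarrow> bool" where
  "irreducible_representation G n \<rho> \<longleftrightarrow>
     representation G n \<rho> \<and>
     (\<forall>W. subspace class_ring W (module_vec TYPE(complex) n) \<longrightarrow>
          (\<forall>g\<in>carrier G. \<forall>w\<in>W. \<rho> g *\<^sub>v w \<in> W) \<longrightarrow>
          W = {0\<^sub>v n} \<or> W = carrier_vec n)"

definition rep_character ::
    "('a, 'b) monoid_scheme \<Rightarrow> nat \<Rightarrow> ('a \<Rightarrow> complex mat) \<Rightarrow> 'a \<Rightarrow> complex" where
  "rep_character G n \<rho> = (\<lambda>g. if g \<in> carrier G then \<Sum>i<n. \<rho> g $$ (i, i) else 0)"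

definition characters :: "('a, 'b) monoid_scheme \<Rightarrow> ('a \<Rightarrow> complex) set" where
  "characters G = {rep_character G n \<rho> | n \<rho>. representation G n \<rho>}"

definition Irr :: "('a, 'b) monoid_scheme \<Rightarrow> ('a \<Rightarrow> complex) set" where
  "Irr G = {rep_character G n \<rho> | n \<rho>. irreducible_representation G n \<rho>}"

(* The degree of a character is its value at the identity. *)
definition linear_characters :: "('a, 'b) monoid_scheme \<Rightarrow> ('a \<Rightarrow> complex) set" where
  "linear_characters G = {\<theta> \<in> characters G. \<theta> \<one>\<^bsub>G\<^esub> = 1}"

definition induced ::
    "('a, 'b) monoid_scheme \<Rightarrow> 'a set \<Rightarrow> ('a \<Rightarrow> complex) \<Rightarrow> 'a \<Rightarrow> complex" where
  "induced G H \<theta> = (\<lambda>g. if g \<in> carrier G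
     then (\<Sum>x \<in> {x \<in> carrier G. x \<otimes>\<^bsub>G\<^esub> g \<otimes>\<^bsub>G\<^esub> inv\<^bsub>G\<^esub> x \<in> H}.
             \<theta> (x \<otimes>\<^bsub>G\<^esub> g \<otimes>\<^bsub>G\<^esub> inv\<^bsub>G\<^esub> x)) / of_nat (card H)
     else 0)"

definition char_inner ::
    "('a, 'b) monoid_scheme \<Rightarrow> ('a \<Rightarrow> complex) \<Rightarrow> ('a \<Rightarrow> complex) \<Rightarrow> complex" where
  "char_inner G \<phi> \<chi> = (\<Sum>g\<in>carrier G. \<phi> g * cnj (\<chi> g)) / of_nat (card (carrier G))"

(* The order on the complex numbers is the one of Complex_Order: 0 < z means that z is real and
   positive. *)
definition constituents :: "('a, 'b) monoid_scheme \<Rightarrow> ('a \<Rightarrow> complex) \<Rightarrow> ('a \<Rightarrow> complex) set" where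
  "constituents G \<chi> = {\<phi> \<in> Irr G. 0 < char_inner G \<phi> \<chi>}"

definition monomial_characters :: "('a, 'b) monoid_scheme \<Rightarrow> ('a \<Rightarrow> complex) set" where
  "monomial_characters G =
     {induced G H \<mu> | H \<mu>. subgroup H G \<and> \<mu> \<in> linear_characters (G\<lparr>carrier := H\<rparr>)}"

definition almost_monomial :: "('a, 'b) monoid_scheme \<Rightarrow> bool" where
  "almost_monomial G \<longleftrightarrow>
     (\<forall>\<chi>\<in>Irr G. \<forall>\<phi>\<in>Irr G. \<chi> \<noteq> \<phi> \<longrightarrow>
        (\<exists>H \<mu>. subgroup H G \<and> \<mu> \<in> linear_characters (G\<lparr>carrier := H\<rparr>) \<and>
               \<chi> \<in> constituents G (induced G H \<mu>) \<and> \<phi> \<notin> constituents G (induced G H \<mu>)))"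

(* Only nonempty sums: the subsemigroup generated by the monomial characters does not contain
   the zero function. *)
definition M_sums :: "('a, 'b) monoid_scheme \<Rightarrow> ('a \<Rightarrow> complex) set" where
  "M_sums G = {(\<lambda>g. \<Sum>i<k. \<psi> i g) | k \<psi>.
            1 \<le> (k::nat) \<and> (\<forall>i<k. \<psi> i \<in> monomial_characters G)}"

definition L_num :: "nat \<Rightarrow> ('a, 'b) monoid_scheme \<Rightarrow> nat" where
  "L_num t G = card {constituents G \<chi> | \<chi>. \<chi> \<in> M_sums G \<and> card (constituents G \<chi>) = t}"

(* Meant for 1 \<le> t \<le> r - 1, where the subtractions on nat are exact. *)
definition N_num :: "nat \<Rightarrow> nat \<Rightarrow> int" where
  "N_num r t = int (r choose t) - int ((r - 2) choose (t - 1)) + 1"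

end

theory Submission
  imports Defs "Jordan_Normal_Form.Schur_Decomposition" "HOL-Algebra.Multiplicative_Group"
begin

text \<open>
  Everything about the group enters through the family \<open>F\<close> of constituent sets
  \<open>Cons(\<psi>)\<close>, \<open>\<psi> \<in> M(G)\<close>. A multiplicity \<open>\<langle>\<phi>, \<lambda>\<^sup>G\<rangle>\<close> is never negative, so multiplicities cannot
  cancel in a sum: \<open>Cons(\<psi> + \<psi>') = Cons(\<psi>) \<union> Cons(\<psi>')\<close>. Hence \<open>F\<close> is closed under unions, and
  \<open>G\<close> is almost monomial iff \<open>F\<close> separates points: for \<open>\<chi> \<noteq> \<phi>\<close> some member of \<open>F\<close> contains
  \<open>\<chi>\<close> and omits \<open>\<phi>\<close>.

  The rest is about a union-closed family \<open>F\<close> of subsets of an \<open>r\<close>-element set \<open>I\<close>,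
  where \<open>r \<ge> 2\<close> because \<open>Irr(G)\<close> contains the trivial character and \<open>r \<noteq> 1\<close>
  (\<open>union_closed_separates_points_iff\<close>). If \<open>F\<close> separates points, then each \<open>I - {\<phi>}\<close> is the union
  of one separating member for each \<open>\<chi> \<noteq> \<phi>\<close>, so all \<open>r\<close> subsets of size \<open>r - 1\<close> are in \<open>F\<close>.
  That is the bound on \<open>L\<^sub>t(G)\<close> at \<open>t = r - 1\<close>, since \<open>N\<^bsub>r,r-1\<^esub> = r\<close>. Conversely, if \<open>F\<close> fails to
  separate \<open>\<chi>\<close> from \<open>\<phi>\<close>, it contains none of the \<open>binom(r-2, t-1)\<close> sets of size \<open>t\<close> that
  contain \<open>\<chi>\<close> and omit \<open>\<phi>\<close>, so it has fewer than \<open>N\<^bsub>r,t\<^esub>\<close> members of size \<open>t\<close>.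

  Two facts of character theory carry this, and both follow from writing a trace as a sum of
  eigenvalues.
  \<^item> \<open>\<langle>\<phi>, \<lambda>\<^sup>G\<rangle> \<ge> 0\<close> (\<open>monomial_multiplicity_nonneg\<close>): by Frobenius reciprocity it is the trace of the
    average of \<open>cnj(\<lambda>(h)) \<rho>(h)\<close> over \<open>h \<in> H\<close>. That matrix is idempotent, so its eigenvalues are
    \<open>0\<close> and \<open>1\<close>.
  \<^item> \<open>Irr(G)\<close> is finite (\<open>finite_Irr\<close>): an irreducible representation is spanned by the orbit
    of one vector, so its degree is at most \<open>|G|\<close>. A character value is then a sum of at most \<open>|G|\<close>
    roots of unity of order dividing \<open>|G|\<close>, which leaves finitely many values and so finitely
    many functions on \<open>G\<close>.
\<close>

section \<open>Traces and eigenvalues of complex matrices\<close>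

abbreviation mat_trace :: "nat \<Rightarrow> complex mat \<Rightarrow> complex" where
  "mat_trace n A \<equiv> \<Sum>i<n. A $$ (i, i)"

lemma index_mult_mat_sum:
  assumes "A \<in> carrier_mat n m" "B \<in> carrier_mat m k" "i < n" "j < k"
  shows "(A * B) $$ (i, j) = (\<Sum>l<m. A $$ (i, l) * B $$ (l, j))"
proof -
  have "(A * B) $$ (i, j) = row A i \<bullet> col B j" using assms by simp
  also have "\<dots> = (\<Sum>l<m. A $$ (i, l) * B $$ (l, j))"
    unfolding scalar_prod_def using assms by (intro sum.cong) auto
  finally show ?thesis .
qed

lemma mat_trace_mult_commute:
  assumes "A \<in> carrier_mat n n" "B \<in> carrier_mat n n"
  shows "mat_trace n (A * B) = mat_trace n (B * A)"
proof -
  have "mat_trace n (A * B) = (\<Sum>i<n. \<Sum>l<n. A $$ (i, l) * B $$ (l, i))"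
    using assms by (intro sum.cong) (auto simp: index_mult_mat_sum simp del: index_mult_mat)
  also have "\<dots> = (\<Sum>l<n. \<Sum>i<n. B $$ (l, i) * A $$ (i, l))"
    by (subst sum.swap) (simp add: mult.commute)
  also have "\<dots> = mat_trace n (B * A)"
    using assms by (intro sum.cong) (auto simp: index_mult_mat_sum simp del: index_mult_mat)
  finally show ?thesis .
qed

text \<open>A complex matrix is similar to a triangular one by Schur decomposition, and the trace is
  invariant under similarity.\<close>

lemma mat_trace_eq_sum_eigenvalues:
  assumes A: "A \<in> carrier_mat n n"
  obtains es where "length es = n" "\<And>e. e \<in> set es \<Longrightarrow> eigenvalue A e"
    "mat_trace n A = sum_list es"
proof -
  from char_poly_factorized[OF A] obtain es where
    cp: "char_poly A = (\<Prod>e\<leftarrow>es. [:- e, 1:])" and len: "length es = n" by blast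
  obtain B P Q where "schur_decomposition A es = (B, P, Q)"
    by (cases "schur_decomposition A es") auto
  from schur_decomposition[OF A cp this]
  have sim: "similar_mat_wit A B P Q" and diag: "diag_mat B = es" by auto
  from similar_mat_witD2[OF A sim]
  have B: "B \<in> carrier_mat n n" and P: "P \<in> carrier_mat n n" and Q: "Q \<in> carrier_mat n n"
    and QP: "Q * P = 1\<^sub>m n" and A_eq: "A = P * B * Q" by auto
  have "mat_trace n A = mat_trace n (Q * (P * B))"
    unfolding A_eq using P B Q by (intro mat_trace_mult_commute) auto
  also have "Q * (P * B) = B"
    using P B Q QP by (metis assoc_mult_mat left_mult_one_mat)
  also have "mat_trace n B = sum_list es"
    unfolding diag[symmetric] diag_mat_def using B
    by (simp add: sum_list_sum_nth lessThan_atLeast0)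
  finally have "mat_trace n A = sum_list es" .
  moreover have "eigenvalue A e" if "e \<in> set es" for e
    unfolding eigenvalue_root_char_poly[OF A] cp using that by (rule linear_poly_root)
  ultimately show thesis using len that by blast
qed

text \<open>The eigenvalues satisfy \<open>e\<^sup>2 = e\<close>. The order on \<open>complex\<close> makes \<open>0 \<le> z\<close> say that \<open>z\<close> is real
  as well.\<close>

lemma idempotent_mat_trace_nonneg:
  assumes E: "E \<in> carrier_mat n n" and idem: "E * E = E"
  shows "0 \<le> mat_trace n E"
proof -
  obtain es where eig: "\<And>e. e \<in> set es \<Longrightarrow> eigenvalue E e" and tr: "mat_trace n E = sum_list es"
    using mat_trace_eq_sum_eigenvalues[OF E] by metis
  have zero_or_one: "e = 0 \<or> e = 1" if "e \<in> set es" for e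
  proof -
    from eig[OF that] E obtain v where v: "v \<in> carrier_vec n" "v \<noteq> 0\<^sub>v n" and Ev: "E *\<^sub>v v = e \<cdot>\<^sub>v v"
      unfolding eigenvalue_def eigenvector_def by auto
    have "e \<cdot>\<^sub>v v = (E * E) *\<^sub>v v" by (simp add: idem Ev)
    also have "\<dots> = E *\<^sub>v (e \<cdot>\<^sub>v v)" using E v(1) by (simp add: assoc_mult_mat_vec Ev)
    also have "\<dots> = (e * e) \<cdot>\<^sub>v v" using mult_mat_vec[OF E v(1)] by (simp add: Ev smult_smult_assoc)
    finally have eq: "e \<cdot>\<^sub>v v = (e * e) \<cdot>\<^sub>v v" .
    from v obtain i where i: "i < n" "v $ i \<noteq> 0" by (metis eq_vecI carrier_vecD index_zero_vec)
    have "e * v $ i = (e * e) * v $ i" using arg_cong[OF eq, of "\<lambda>w. w $ i"] i(1) v(1) by simp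
    thus ?thesis using i(2) by auto
  qed
  have "0 \<le> e" if "e \<in> set es" for e
    using zero_or_one[OF that] by (auto simp: less_eq_complex_def)
  thus ?thesis unfolding tr by (rule sum_list_nonneg)
qed

section \<open>Representations of finite groups\<close>

lemma representationD:
  assumes "representation G n \<rho>"
  shows representation_carrier: "g \<in> carrier G \<Longrightarrow> \<rho> g \<in> carrier_mat n n"
    and representation_mult: "g \<in> carrier G \<Longrightarrow> h \<in> carrier G \<Longrightarrow> \<rho> (g \<otimes>\<^bsub>G\<^esub> h) = \<rho> g * \<rho> h"
    and representation_dim_pos: "1 \<le> n"
  using assms unfolding representation_def hom_def units_of_def Units_def
  by (auto simp: ring_mat_simps)

lemma representation_one:
  assumes "group G" and "representation G n \<rho>"
  shows "\<rho> \<one>\<^bsub>G\<^esub> = 1\<^sub>m n"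
proof -
  interpret M: ring "ring_mat TYPE(complex) n ()" by (rule ring_mat)
  have "group (general_linear_group n)" by (rule M.units_group)
  from hom_one[OF _ assms(1) this, of \<rho>] assms(2) show ?thesis
    by (simp add: representation_def units_of_def ring_mat_simps)
qed

lemma representation_pow:
  assumes "group G" and rep: "representation G n \<rho>" and g: "g \<in> carrier G"
  shows "\<rho> (g [^]\<^bsub>G\<^esub> (k :: nat)) = \<rho> g ^\<^sub>m k"
proof (induction k)
  case 0
  show ?case using representation_one[OF assms(1,2)] representation_carrier[OF rep g]
    by (simp add: monoid.nat_pow_0[OF group.is_monoid[OF assms(1)]])
next
  case (Suc k)
  interpret group G by fact
  show ?case using Suc representation_mult[OF rep _ g] g by simp
qed

lemma representation_restrict:
  assumes "subgroup H G" and "representation G n \<rho>"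
  shows "representation (G\<lparr>carrier := H\<rparr>) n \<rho>"
  using assms subgroup.subset[OF assms(1)] unfolding representation_def hom_def by auto

lemma rep_character_conj:
  fixes G (structure)
  assumes "group G" and rep: "representation G n \<rho>" and g: "g \<in> carrier G" and x: "x \<in> carrier G"
  shows "rep_character G n \<rho> (x \<otimes>\<^bsub>G\<^esub> g \<otimes>\<^bsub>G\<^esub> inv\<^bsub>G\<^esub> x) = rep_character G n \<rho> g"
proof -
  interpret group G by fact
  note mult = representation_mult[OF rep] and carr = representation_carrier[OF rep]
  have "mat_trace n (\<rho> ((x \<otimes> g) \<otimes> inv x)) = mat_trace n (\<rho> (inv x) * \<rho> (x \<otimes> g))"
    using g x by (subst mult) (auto intro!: mat_trace_mult_commute carr)
  also have "\<rho> (inv x) * \<rho> (x \<otimes> g) = \<rho> g"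
    using g x by (subst mult[symmetric]) (auto simp: m_assoc[symmetric])
  finally show ?thesis using g x by (simp add: rep_character_def)
qed

lemma Irr_cases:
  assumes "\<phi> \<in> Irr G"
  obtains n \<rho> where "irreducible_representation G n \<rho>" "representation G n \<rho>"
    "\<phi> = rep_character G n \<rho>"
  using assms unfolding Irr_def irreducible_representation_def by blast

text \<open>The span of the orbit of a nonzero vector is nonzero and invariant, hence the whole space;
  the orbit has at most \<open>|G|\<close> elements.\<close>

lemma irreducible_representation_dim_le_order:
  fixes G (structure)
  assumes G: "group G" and fin: "finite (carrier G)" and irr: "irreducible_representation G n \<rho>"
  shows "n \<le> Coset.order G"
proof -
  interpret group G by fact
  interpret V: vec_space "TYPE(complex)" n .
  have rep: "representation G n \<rho>" using irr by (simp add: irreducible_representation_def)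
  note carr = representation_carrier[OF rep] and mult = representation_mult[OF rep]
  have n: "0 < n" using representation_dim_pos[OF rep] by simp
  define v :: "complex vec" where "v = unit_vec n 0"
  have v: "v \<in> carrier_vec n" by (simp add: v_def)
  define S where "S = (\<lambda>g. \<rho> g *\<^sub>v v) ` carrier G"
  have S: "S \<subseteq> carrier_vec n" and finS: "finite S"
    using carr v fin by (auto simp: S_def intro!: mult_mat_vec_carrier)
  have sub: "VectorSpace.subspace class_ring (V.span S) (module_vec TYPE(complex) n)"
    using V.span_is_subspace[OF S] .
  have inv: "\<rho> g *\<^sub>v w \<in> V.span S" if g: "g \<in> carrier G" and w: "w \<in> V.span S" for g w
  proof -
    \<comment> \<open>The vectors sent into the span form a submodule; it contains the generators, hence the span.\<close>
    let ?N = "{w \<in> carrier_vec n. \<rho> g *\<^sub>v w \<in> V.span S}"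
    have "submodule class_ring ?N (module_vec TYPE(complex) n)"
    proof (rule submodule.intro)
      show "Module.module class_ring (module_vec TYPE(complex) n)" by (rule vec_module)
      show "?N \<subseteq> carrier (module_vec TYPE(complex) n)" by (auto simp: module_vec_simps)
      show "\<zero>\<^bsub>module_vec TYPE(complex) n\<^esub> \<in> ?N"
        using mult_mat_vec[OF carr[OF g] zero_carrier_vec, of 0] carr[OF g]
          submodule.zero_closed[OF V.span_is_submodule[OF S]]
        by (simp add: module_vec_simps)
      show "a \<oplus>\<^bsub>module_vec TYPE(complex) n\<^esub> b \<in> ?N" if "a \<in> ?N" "b \<in> ?N" for a b
        using that mult_add_distrib_mat_vec[OF carr[OF g]] V.span_add1[OF S]
        by (auto simp: module_vec_simps)
      show "c \<odot>\<^bsub>module_vec TYPE(complex) n\<^esub> a \<in> ?N" if "a \<in> ?N" for c a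
        using that mult_mat_vec[OF carr[OF g]] V.smult_in_span[OF S]
        by (auto simp: module_vec_simps)
    qed
    moreover have "S \<subseteq> ?N"
    proof
      fix s assume "s \<in> S"
      then obtain h where h: "h \<in> carrier G" and s: "s = \<rho> h *\<^sub>v v" by (auto simp: S_def)
      have "\<rho> g *\<^sub>v s = \<rho> (g \<otimes> h) *\<^sub>v v"
        using carr[OF g] carr[OF h] v by (simp add: s mult[OF g h] assoc_mult_mat_vec)
      hence "\<rho> g *\<^sub>v s \<in> S" using g h by (auto simp: S_def)
      thus "s \<in> ?N" using S \<open>s \<in> S\<close> V.in_own_span[OF S] by auto
    qed
    ultimately have "V.span S \<subseteq> ?N" by (intro V.span_is_subset)
    thus ?thesis using w by auto
  qed
  have "V.span S = {0\<^sub>v n} \<or> V.span S = carrier_vec n"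
    using irr sub inv unfolding irreducible_representation_def by blast
  moreover have "V.span S \<noteq> {0\<^sub>v n}"
  proof
    assume zero: "V.span S = {0\<^sub>v n}"
    have "v = \<rho> \<one> *\<^sub>v v" using representation_one[OF G rep] v by simp
    hence "v \<in> S" by (auto simp: S_def)
    hence "v = 0\<^sub>v n" using zero V.in_own_span[OF S] by auto
    hence "v $ 0 = 0" using n by simp
    thus False using n by (simp add: v_def)
  qed
  ultimately have "V.gen_set S" by simp
  hence "V.dim \<le> card S" using V.gen_ge_dim[OF finS] S by simp
  also have "card S \<le> Coset.order G" unfolding S_def Coset.order_def by (rule card_image_le[OF fin])
  finally show ?thesis by (simp add: V.dim_is_n)
qed

text \<open>By Lagrange \<open>g\<close> to the power \<open>|G|\<close> is the identity, so each eigenvalue of \<open>\<rho> g\<close> is a root of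
  unity of order dividing \<open>|G|\<close>.\<close>

lemma rep_character_sum_roots_of_unity:
  assumes G: "group G" and fin: "finite (carrier G)" and rep: "representation G n \<rho>"
    and g: "g \<in> carrier G"
  obtains es where "length es = n" "set es \<subseteq> {z. z ^ Coset.order G = 1}"
    "rep_character G n \<rho> g = sum_list es"
proof -
  interpret group G by fact
  have A: "\<rho> g \<in> carrier_mat n n" using representation_carrier[OF rep g] .
  obtain es where len: "length es = n" and eig: "\<And>e. e \<in> set es \<Longrightarrow> eigenvalue (\<rho> g) e"
    and tr: "mat_trace n (\<rho> g) = sum_list es"
    using mat_trace_eq_sum_eigenvalues[OF A] by metis
  have "e ^ Coset.order G = 1" if "e \<in> set es" for e
  proof -
    from eig[OF that] A obtain v where ev: "eigenvector (\<rho> g) v e"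
      and v: "v \<in> carrier_vec n" "v \<noteq> 0\<^sub>v n"
      unfolding eigenvalue_def eigenvector_def by auto
    have "\<rho> g ^\<^sub>m Coset.order G = 1\<^sub>m n"
      using representation_pow[OF G rep g, of "Coset.order G"] representation_one[OF G rep]
      by (simp add: pow_order_eq_1[OF g])
    hence eq: "e ^ Coset.order G \<cdot>\<^sub>v v = v" using eigenvector_pow[OF A ev, of "Coset.order G"] v by simp
    from v obtain i where i: "i < n" "v $ i \<noteq> 0" by (metis eq_vecI carrier_vecD index_zero_vec)
    have "e ^ Coset.order G * v $ i = v $ i" using arg_cong[OF eq, of "\<lambda>w. w $ i"] i(1) v(1) by simp
    thus ?thesis using i(2) by auto
  qed
  thus thesis using that[OF len] tr g by (auto simp: rep_character_def)
qed

text \<open>Bounding the degrees and the character values is enough: it confines \<open>Irr G\<close> to a finite set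
  of functions.\<close>

lemma finite_Irr:
  assumes G: "group G" and fin: "finite (carrier G)"
  shows "finite (Irr G)"
proof -
  interpret group G by fact
  have pos: "0 < Coset.order G" using fin order_gt_0_iff_finite by blast
  let ?R = "{z :: complex. z ^ Coset.order G = 1}"
  define Z where "Z = sum_list ` {es. set es \<subseteq> ?R \<and> length es \<le> Coset.order G}"
  have "finite ?R" using pos by (intro finite_roots_unity) simp
  hence "finite Z" unfolding Z_def by (intro finite_imageI finite_lists_length_le)
  have "Irr G \<subseteq> {f. \<forall>g. (g \<in> carrier G \<longrightarrow> f g \<in> Z) \<and> (g \<notin> carrier G \<longrightarrow> f g = 0)}"
  proof (clarify, intro conjI impI)
    fix \<phi> g assume "\<phi> \<in> Irr G"
    then obtain n \<rho> where irr: "irreducible_representation G n \<rho>" and rep: "representation G n \<rho>"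
      and \<phi>: "\<phi> = rep_character G n \<rho>" by (rule Irr_cases)
    show "\<phi> g \<in> Z" if "g \<in> carrier G"
    proof -
      obtain es where "length es = n" "set es \<subseteq> ?R" "rep_character G n \<rho> g = sum_list es"
        using rep_character_sum_roots_of_unity[OF G fin rep \<open>g \<in> carrier G\<close>] by metis
      thus ?thesis using irreducible_representation_dim_le_order[OF G fin irr]
        by (auto simp: Z_def \<phi>)
    qed
    show "\<phi> g = 0" if "g \<notin> carrier G" using that by (simp add: \<phi> rep_character_def)
  qed
  thus ?thesis using finite_set_of_finite_funs[OF fin \<open>finite Z\<close>, of 0] by (rule finite_subset)
qed

text \<open>The trivial representation is irreducible, because a line has no proper nonzero subspace.\<close>

lemma Irr_nonempty:
  assumes "group G"
  shows "Irr G \<noteq> {}"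
proof -
  define \<rho> :: "'a \<Rightarrow> complex mat" where "\<rho> = (\<lambda>_. 1\<^sub>m 1)"
  have rep: "representation G 1 \<rho>"
    unfolding representation_def hom_def units_of_def Units_def \<rho>_def
    by (auto simp: ring_mat_simps)
  have "W = {0\<^sub>v 1} \<or> W = carrier_vec 1"
    if W: "VectorSpace.subspace class_ring W (module_vec TYPE(complex) 1)" for W
  proof -
    interpret W: submodule class_ring W "module_vec TYPE(complex) 1"
      using W by (simp add: VectorSpace.subspace_def)
    have sub: "W \<subseteq> carrier_vec 1" and zero: "0\<^sub>v 1 \<in> W"
      using W.subset W.zero_closed by (auto simp: module_vec_simps)
    have "carrier_vec 1 \<subseteq> W" if "w \<in> W" "w \<noteq> 0\<^sub>v 1" for w
    proof
      fix u :: "complex vec" assume u: "u \<in> carrier_vec 1"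
      have w: "w \<in> carrier_vec 1" using sub that by auto
      have "w $ 0 \<noteq> 0" using that(2) w by (metis eq_vecI carrier_vecD index_zero_vec less_one)
      hence "u = (u $ 0 / w $ 0) \<cdot>\<^sub>v w" using u w by (intro eq_vecI) auto
      moreover have "(u $ 0 / w $ 0) \<cdot>\<^sub>v w \<in> W"
        using W.smult_closed[of "u $ 0 / w $ 0" w] that(1) by (simp add: module_vec_simps)
      ultimately show "u \<in> W" by simp
    qed
    thus ?thesis using sub zero by auto
  qed
  hence "irreducible_representation G 1 \<rho>" using rep by (auto simp: irreducible_representation_def)
  thus ?thesis unfolding Irr_def by blast
qed

section \<open>Multiplicities in monomial characters\<close>

lemma (in group) sum_translate:
  assumes "h \<in> carrier G"
  shows "(\<Sum>k\<in>carrier G. f (h \<otimes> k)) = (\<Sum>k\<in>carrier G. f k)"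
  using assms
  by (intro sum.reindex_bij_witness[where i = "\<lambda>k. inv h \<otimes> k" and j = "\<lambda>k. h \<otimes> k"])
     (auto simp: m_assoc[symmetric])

lemma (in group) sum_conjugate:
  assumes x: "x \<in> carrier G"
  shows "(\<Sum>g\<in>carrier G. f (x \<otimes> g \<otimes> inv x)) = (\<Sum>g\<in>carrier G. f g)"
proof -
  have cancel: "y \<otimes> (inv y \<otimes> g \<otimes> y) \<otimes> inv y = g" if "y \<in> carrier G" "g \<in> carrier G" for y g
    using that by (simp add: m_assoc r_inv) (simp add: m_assoc[symmetric])
  show ?thesis
    using x cancel[OF x] cancel[of "inv x"]
    by (intro sum.reindex_bij_witness[where i = "\<lambda>g. inv x \<otimes> g \<otimes> x" and j = "\<lambda>g. x \<otimes> g \<otimes> inv x"]) auto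
qed

text \<open>The sum is the trace of the average \<open>E\<close> of \<open>\<nu>(k) \<rho>(k)\<close> over the group. Translation by a group
  element permutes the terms of \<open>E\<^sup>2\<close>, so that \<open>E\<^sup>2 = E\<close>. When \<open>\<nu>\<close> is a linear character,
  \<open>E\<close> projects onto the vectors on which the group acts through \<open>1 / \<nu>\<close>.\<close>

lemma twisted_average_nonneg:
  fixes \<nu> :: "'a \<Rightarrow> complex"
  assumes K: "group K" and fin: "finite (carrier K)" and rep: "representation K n \<rho>"
    and \<nu>: "\<And>h k. h \<in> carrier K \<Longrightarrow> k \<in> carrier K \<Longrightarrow> \<nu> (h \<otimes>\<^bsub>K\<^esub> k) = \<nu> h * \<nu> k"
  shows "0 \<le> (\<Sum>h\<in>carrier K. rep_character K n \<rho> h * \<nu> h) / of_nat (card (carrier K))"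
proof -
  interpret group K by fact
  note carr = representation_carrier[OF rep] and mult = representation_mult[OF rep]
  let ?K = "carrier K" and ?c = "of_nat (card (carrier K)) :: complex"
  have c: "?c \<noteq> 0" using fin by auto
  define E where "E = mat n n (\<lambda>(i, j). (\<Sum>h\<in>?K. \<nu> h * \<rho> h $$ (i, j)) / ?c)"
  have E: "E \<in> carrier_mat n n" by (simp add: E_def)
  have "(E * E) $$ (i, j) = E $$ (i, j)" if ij: "i < n" "j < n" for i j
  proof -
    have "(E * E) $$ (i, j) = (\<Sum>l<n. \<Sum>h\<in>?K. \<Sum>k\<in>?K.
        (\<nu> h * \<rho> h $$ (i, l)) * (\<nu> k * \<rho> k $$ (l, j))) / (?c * ?c)"
      using ij E by (subst index_mult_mat_sum[OF E E ij])
        (simp add: E_def sum_divide_distrib sum_product)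
    also have "(\<Sum>l<n. \<Sum>h\<in>?K. \<Sum>k\<in>?K. (\<nu> h * \<rho> h $$ (i, l)) * (\<nu> k * \<rho> k $$ (l, j)))
        = (\<Sum>h\<in>?K. \<Sum>k\<in>?K. \<Sum>l<n. (\<nu> h * \<rho> h $$ (i, l)) * (\<nu> k * \<rho> k $$ (l, j)))"
      by (subst sum.swap, intro sum.cong refl, subst sum.swap) simp
    also have "\<dots> = (\<Sum>h\<in>?K. \<Sum>k\<in>?K. \<nu> (h \<otimes>\<^bsub>K\<^esub> k) * \<rho> (h \<otimes>\<^bsub>K\<^esub> k) $$ (i, j))"
    proof (intro sum.cong refl)
      fix h k assume h: "h \<in> ?K" and k: "k \<in> ?K"
      show "(\<Sum>l<n. (\<nu> h * \<rho> h $$ (i, l)) * (\<nu> k * \<rho> k $$ (l, j)))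
          = \<nu> (h \<otimes>\<^bsub>K\<^esub> k) * \<rho> (h \<otimes>\<^bsub>K\<^esub> k) $$ (i, j)"
        unfolding mult[OF h k] \<nu>[OF h k] index_mult_mat_sum[OF carr[OF h] carr[OF k] ij]
        by (simp add: sum_distrib_left ac_simps)
    qed
    also have "\<dots> = ?c * (\<Sum>k\<in>?K. \<nu> k * \<rho> k $$ (i, j))"
      by (simp add: sum_translate[where f = "\<lambda>g. \<nu> g * \<rho> g $$ (i, j)"])
    finally show ?thesis using c ij by (simp add: E_def)
  qed
  hence "E * E = E" using E by (intro eq_matI) (auto simp del: index_mult_mat(1))
  hence "0 \<le> mat_trace n E" using E by (intro idempotent_mat_trace_nonneg)
  also have "mat_trace n E = (\<Sum>h\<in>?K. rep_character K n \<rho> h * \<nu> h) / ?c"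
  proof -
    have "mat_trace n E = (\<Sum>i<n. \<Sum>h\<in>?K. \<nu> h * \<rho> h $$ (i, i)) / ?c"
      by (simp add: E_def sum_divide_distrib)
    also have "\<dots> = (\<Sum>h\<in>?K. \<Sum>i<n. \<nu> h * \<rho> h $$ (i, i)) / ?c"
      by (subst sum.swap) simp
    also have "\<dots> = (\<Sum>h\<in>?K. rep_character K n \<rho> h * \<nu> h) / ?c"
      by (simp add: rep_character_def sum_distrib_left mult.commute)
    finally show ?thesis .
  qed
  finally show ?thesis .
qed

text \<open>A character takes its degree as value at the identity, so a linear character is the single
  entry of a representation by \<open>1 \<times> 1\<close> matrices.\<close>

lemma linear_character_mult:
  fixes G (structure)
  assumes G: "group G" and "\<mu> \<in> linear_characters G"
    and h: "h \<in> carrier G" and k: "k \<in> carrier G"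
  shows "\<mu> (h \<otimes>\<^bsub>G\<^esub> k) = \<mu> h * \<mu> k"
proof -
  interpret group G by fact
  from assms(2) obtain n \<rho> where rep: "representation G n \<rho>" and \<mu>: "\<mu> = rep_character G n \<rho>"
    and "\<mu> \<one> = 1"
    unfolding linear_characters_def characters_def by auto
  hence "n = 1" using representation_one[OF G rep] by (simp add: rep_character_def)
  thus ?thesis
    using index_mult_mat_sum[OF representation_carrier[OF rep h] representation_carrier[OF rep k], of 0 0] h k
    by (simp add: \<mu> rep_character_def representation_mult[OF rep h k])
qed

text \<open>Extending \<open>\<phi> \<cdot> cnj \<mu>\<close> by \<open>0\<close> outside \<open>H\<close> turns the left-hand side into a double sum over
  \<open>g, x \<in> G\<close> of its values at the conjugates of \<open>g\<close> by \<open>x\<close>; each \<open>x\<close> contributes the same sum.\<close>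

lemma frobenius_reciprocity:
  fixes G (structure)
  assumes G: "group G" and fin: "finite (carrier G)" and H: "subgroup H G"
    and conj: "\<And>x g. x \<in> carrier G \<Longrightarrow> g \<in> carrier G \<Longrightarrow> \<phi> (x \<otimes>\<^bsub>G\<^esub> g \<otimes>\<^bsub>G\<^esub> inv\<^bsub>G\<^esub> x) = \<phi> g"
  shows "char_inner G \<phi> (induced G H \<mu>) = char_inner (G\<lparr>carrier := H\<rparr>) \<phi> \<mu>"
proof -
  interpret group G by fact
  let ?C = "carrier G"
  have c: "of_nat (card ?C) \<noteq> (0 :: complex)" using fin by auto
  have HC: "H \<subseteq> ?C" using H by (rule subgroup.subset)
  define F where "F = (\<lambda>y. if y \<in> H then \<phi> y * cnj (\<mu> y) else 0)"
  have "\<phi> g * cnj (induced G H \<mu> g) = (\<Sum>x\<in>?C. F (x \<otimes> g \<otimes> inv x)) / of_nat (card H)"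
    if g: "g \<in> ?C" for g
  proof -
    have "\<phi> g * (\<Sum>x \<in> {x \<in> ?C. x \<otimes> g \<otimes> inv x \<in> H}. cnj (\<mu> (x \<otimes> g \<otimes> inv x)))
        = (\<Sum>x \<in> {x \<in> ?C. x \<otimes> g \<otimes> inv x \<in> H}. F (x \<otimes> g \<otimes> inv x))"
      unfolding sum_distrib_left using g by (intro sum.cong) (auto simp: F_def conj)
    also have "\<dots> = (\<Sum>x\<in>?C. F (x \<otimes> g \<otimes> inv x))"
      using fin by (intro sum.mono_neutral_left) (auto simp: F_def)
    finally show ?thesis using g by (simp add: induced_def)
  qed
  hence "(\<Sum>g\<in>?C. \<phi> g * cnj (induced G H \<mu> g))
      = (\<Sum>g\<in>?C. \<Sum>x\<in>?C. F (x \<otimes> g \<otimes> inv x)) / of_nat (card H)"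
    by (simp add: sum_divide_distrib)
  also have "(\<Sum>g\<in>?C. \<Sum>x\<in>?C. F (x \<otimes> g \<otimes> inv x)) = (\<Sum>x\<in>?C. \<Sum>g\<in>?C. F (x \<otimes> g \<otimes> inv x))"
    by (rule sum.swap)
  also have "\<dots> = of_nat (card ?C) * (\<Sum>g\<in>?C. F g)"
    by (simp add: sum_conjugate)
  also have "(\<Sum>g\<in>?C. F g) = (\<Sum>h\<in>H. \<phi> h * cnj (\<mu> h))"
    using fin HC by (intro sum.mono_neutral_cong_right) (auto simp: F_def)
  finally show ?thesis using c by (simp add: char_inner_def)
qed

lemma monomial_multiplicity_nonneg:
  assumes G: "group G" and fin: "finite (carrier G)"
    and \<phi>: "\<phi> \<in> Irr G" and \<psi>: "\<psi> \<in> monomial_characters G"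
  shows "0 \<le> char_inner G \<phi> \<psi>"
proof -
  from \<phi> obtain n \<rho> where rep: "representation G n \<rho>" and \<phi>_eq: "\<phi> = rep_character G n \<rho>"
    by (rule Irr_cases)
  from \<psi> obtain H \<mu> where H: "subgroup H G" and \<mu>: "\<mu> \<in> linear_characters (G\<lparr>carrier := H\<rparr>)"
    and \<psi>_eq: "\<psi> = induced G H \<mu>"
    unfolding monomial_characters_def by auto
  let ?K = "G\<lparr>carrier := H\<rparr>"
  have K: "group ?K" using H G by (rule subgroup.subgroup_is_group)
  have HC: "H \<subseteq> carrier G" using H by (rule subgroup.subset)
  have "0 \<le> (\<Sum>h\<in>carrier ?K. rep_character ?K n \<rho> h * cnj (\<mu> h)) / of_nat (card (carrier ?K))"
    using K finite_subset[OF HC fin] representation_restrict[OF H rep] linear_character_mult[OF K \<mu>]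
    by (intro twisted_average_nonneg) auto
  also have "\<dots> = char_inner ?K \<phi> \<mu>"
    using HC by (auto simp: char_inner_def rep_character_def \<phi>_eq
        intro!: arg_cong2[of _ _ _ _ "(/)"] sum.cong)
  also have "\<dots> = char_inner G \<phi> \<psi>"
    unfolding \<psi>_eq \<phi>_eq
    by (intro frobenius_reciprocity[symmetric] G fin H rep_character_conj[OF G rep])
  finally show ?thesis .
qed

lemma char_inner_sum:
  "char_inner G \<phi> (\<lambda>g. \<Sum>i<(k::nat). \<psi> i g) = (\<Sum>i<k. char_inner G \<phi> (\<psi> i))"
  unfolding char_inner_def sum_divide_distrib[symmetric]
  by (subst sum.swap) (simp add: sum_distrib_left)

section \<open>Union-closed families that separate points\<close>

definition separates_points :: "'c set \<Rightarrow> 'c set set \<Rightarrow> bool" where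
  "separates_points I F \<longleftrightarrow> (\<forall>x\<in>I. \<forall>y\<in>I. x \<noteq> y \<longrightarrow> (\<exists>A\<in>F. x \<in> A \<and> y \<notin> A))"

lemma card_subsets_containing_avoiding:
  assumes fin: "finite I" and x: "x \<in> I" and y: "y \<in> I" and xy: "x \<noteq> y" and t: "1 \<le> t"
  shows "card {A. A \<subseteq> I \<and> card A = t \<and> x \<in> A \<and> y \<notin> A} = (card I - 2) choose (t - 1)"
proof -
  let ?J = "I - {x, y}"
  have "bij_betw (insert x) {B. B \<subseteq> ?J \<and> card B = t - 1}
      {A. A \<subseteq> I \<and> card A = t \<and> x \<in> A \<and> y \<notin> A}"
  proof (intro bij_betw_byWitness[where f' = "\<lambda>A. A - {x}"])
    show "insert x ` {B. B \<subseteq> ?J \<and> card B = t - 1} \<subseteq> {A. A \<subseteq> I \<and> card A = t \<and> x \<in> A \<and> y \<notin> A}"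
    proof clarify
      fix B assume B: "B \<subseteq> ?J" and "card B = t - 1"
      moreover have "finite B" "x \<notin> B" using B fin finite_subset by auto
      ultimately show "insert x B \<subseteq> I \<and> card (insert x B) = t \<and> x \<in> insert x B \<and> y \<notin> insert x B"
        using x xy t by auto
    qed
  qed auto
  hence "card {A. A \<subseteq> I \<and> card A = t \<and> x \<in> A \<and> y \<notin> A} = card {B. B \<subseteq> ?J \<and> card B = t - 1}"
    by (simp add: bij_betw_same_card)
  also have "\<dots> = card ?J choose (t - 1)" using fin by (intro n_subsets) simp
  also have "card ?J = card I - 2" using fin x y xy by (simp add: card_Diff_subset)
  finally show ?thesis .
qed

text \<open>If no member contains \<open>x\<close> and omits \<open>y\<close>, then the sets of size \<open>t\<close> that do so are all missing
  from \<open>F\<close>, and \<open>N_num\<close> exceeds by one the number of the remaining sets of size \<open>t\<close>.\<close>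

lemma separates_points_if_many_members:
  assumes fin: "finite I" and F: "F \<subseteq> Pow I" and t: "1 \<le> t"
    and many: "N_num (card I) t \<le> int (card {A \<in> F. card A = t})"
  shows "separates_points I F"
proof (rule ccontr)
  assume "\<not> separates_points I F"
  then obtain x y where x: "x \<in> I" and y: "y \<in> I" and xy: "x \<noteq> y"
    and no: "\<And>A. A \<in> F \<Longrightarrow> x \<in> A \<Longrightarrow> y \<in> A"
    unfolding separates_points_def by blast
  let ?T = "{A. A \<subseteq> I \<and> card A = t}" and ?S = "{A. A \<subseteq> I \<and> card A = t \<and> x \<in> A \<and> y \<notin> A}"
  have finT: "finite ?T" using fin by (auto intro: finite_subset[of _ "Pow I"])
  have ST: "?S \<subseteq> ?T" by blast
  have "{A \<in> F. card A = t} \<subseteq> ?T - ?S" using F no by blast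
  hence "card {A \<in> F. card A = t} \<le> card (?T - ?S)" using finT by (intro card_mono) auto
  also have "\<dots> = card ?T - card ?S"
    using finT ST by (intro card_Diff_subset) (auto intro: finite_subset)
  finally have "int (card {A \<in> F. card A = t}) \<le> int (card ?T) - int (card ?S)"
    using card_mono[OF finT ST] by linarith
  thus False
    using many by (simp add: N_num_def n_subsets[OF fin]
        card_subsets_containing_avoiding[OF fin x y xy t])
qed

text \<open>The complement of \<open>y\<close> is the union, over all \<open>x \<noteq> y\<close>, of members that contain \<open>x\<close> and omit
  \<open>y\<close>. With at least two points this union is not empty, which matters because \<open>F\<close> is only closed
  under unions of two members.\<close>

lemma complements_of_points_if_separates_points:
  assumes fin: "finite I" and two: "2 \<le> card I" and F: "F \<subseteq> Pow I"
    and union: "\<And>A B. A \<in> F \<Longrightarrow> B \<in> F \<Longrightarrow> A \<union> B \<in> F"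
    and sep: "separates_points I F"
  shows "card {A \<in> F. card A = card I - 1} = card I"
proof -
  have mem: "I - {y} \<in> F" if y: "y \<in> I" for y
  proof -
    have "\<forall>x \<in> I - {y}. \<exists>A \<in> F. x \<in> A \<and> y \<notin> A"
      using sep y by (auto simp: separates_points_def)
    then obtain A where A: "\<And>x. x \<in> I - {y} \<Longrightarrow> A x \<in> F \<and> x \<in> A x \<and> y \<notin> A x" by metis
    have unions: "\<Union> (A ` J) \<in> F" if "finite J" "J \<noteq> {}" "J \<subseteq> I - {y}" for J
      using that by (induction rule: finite_ne_induct) (use A union in auto)
    have "I - {y} \<noteq> {}"
      using two y fin card_Diff_singleton[OF y] by (metis card.empty diff_is_0_eq not_less_eq_eq
          numeral_2_eq_2 One_nat_def)
    hence "\<Union> (A ` (I - {y})) \<in> F" using fin by (intro unions) auto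
    moreover have "\<Union> (A ` (I - {y})) = I - {y}" using A F by blast
    ultimately show ?thesis by simp
  qed
  have "{A \<in> F. card A = card I - 1} = {A. A \<subseteq> I \<and> card A = card I - 1}"
  proof (intro equalityI subsetI; clarify)
    fix A assume A: "A \<subseteq> I" "card A = card I - 1"
    have "card (I - A) = 1" using A fin two by (simp add: card_Diff_subset finite_subset)
    then obtain y where "I - A = {y}" by (metis card_1_singletonE)
    hence "A = I - {y}" "y \<in> I" using A by auto
    thus "A \<in> F" using mem by simp
  qed (use F in auto)
  thus ?thesis using two binomial_symmetric[of 1 "card I"] by (simp add: n_subsets[OF fin])
qed

lemma N_num_pred:
  assumes "2 \<le> r"
  shows "N_num r (r - 1) = int r"
proof -
  have "r choose (r - 1) = r" using assms binomial_symmetric[of 1 r] by simp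
  moreover have "r - 1 - 1 = r - 2" by simp
  ultimately show ?thesis by (simp add: N_num_def)
qed

theorem union_closed_separates_points_iff:
  assumes fin: "finite I" and two: "2 \<le> card I" and F: "F \<subseteq> Pow I"
    and union: "\<And>A B. A \<in> F \<Longrightarrow> B \<in> F \<Longrightarrow> A \<union> B \<in> F"
  shows "separates_points I F \<longleftrightarrow>
      (\<exists>t. 1 \<le> t \<and> t \<le> card I - 1 \<and> N_num (card I) t \<le> int (card {A \<in> F. card A = t}))"
    and "separates_points I F \<longleftrightarrow> card {A \<in> F. card A = card I - 1} = card I"
proof -
  let ?sep = "separates_points I F"
    and ?many = "\<exists>t. 1 \<le> t \<and> t \<le> card I - 1 \<and> N_num (card I) t \<le> int (card {A \<in> F. card A = t})"
    and ?all = "card {A \<in> F. card A = card I - 1} = card I"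
  have "?sep \<Longrightarrow> ?all"
    using complements_of_points_if_separates_points[OF fin two F union] .
  moreover have "?all \<Longrightarrow> ?many"
    using two N_num_pred[OF two] by (intro exI[of _ "card I - 1"]) auto
  moreover have "?many \<Longrightarrow> ?sep"
    using separates_points_if_many_members[OF fin F] by blast
  ultimately show "?sep \<longleftrightarrow> ?many" "?sep \<longleftrightarrow> ?all" by blast+
qed

section \<open>The characterization of almost monomial groups\<close>

lemma M_sums_cases:
  assumes "\<psi> \<in> M_sums G"
  obtains k \<alpha> where "1 \<le> (k :: nat)" "\<psi> = (\<lambda>g. \<Sum>i<k. \<alpha> i g)"
    "\<forall>i<k. \<alpha> i \<in> monomial_characters G"
  using assms unfolding M_sums_def mem_Collect_eq by (elim exE conjE) (rule that)

lemma monomial_characters_subset_M_sums: "monomial_characters G \<subseteq> M_sums G"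
proof
  fix \<psi> assume "\<psi> \<in> monomial_characters G"
  moreover have "\<psi> = (\<lambda>g. \<Sum>i<(1::nat). \<psi> g)" by simp
  ultimately show "\<psi> \<in> M_sums G"
    unfolding M_sums_def by (intro CollectI exI[of _ "1::nat"] exI[of _ "\<lambda>_. \<psi>"]) auto
qed

lemma M_sums_add:
  assumes "\<psi> \<in> M_sums G" "\<psi>' \<in> M_sums G"
  shows "(\<lambda>g. \<psi> g + \<psi>' g) \<in> M_sums G"
proof -
  obtain k \<alpha> where k: "1 \<le> (k :: nat)" and \<psi>: "\<psi> = (\<lambda>g. \<Sum>i<k. \<alpha> i g)"
    and \<alpha>: "\<forall>i<k. \<alpha> i \<in> monomial_characters G"
    using M_sums_cases[OF assms(1)] .
  obtain l \<beta> where "1 \<le> l" and \<psi>': "\<psi>' = (\<lambda>g. \<Sum>i<(l :: nat). \<beta> i g)"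
    and \<beta>: "\<forall>i<l. \<beta> i \<in> monomial_characters G"
    using M_sums_cases[OF assms(2)] .
  define \<gamma> where "\<gamma> i = (if i < k then \<alpha> i else \<beta> (i - k))" for i
  have "(\<Sum>i<k. \<alpha> i g) + (\<Sum>i<m. \<beta> i g) = (\<Sum>i<k + m. \<gamma> i g)" for g m
    by (induction m) (simp_all add: \<gamma>_def add.assoc[symmetric])
  moreover have "\<gamma> i \<in> monomial_characters G" if "i < k + l" for i
    using that \<alpha> \<beta> by (auto simp: \<gamma>_def)
  ultimately show ?thesis
    unfolding M_sums_def \<psi> \<psi>' using k by (intro CollectI exI[of _ "k + l"] exI[of _ \<gamma>]) auto
qed

lemma M_sums_multiplicity_nonneg:
  assumes G: "group G" and fin: "finite (carrier G)"
    and \<phi>: "\<phi> \<in> Irr G" and "\<psi> \<in> M_sums G"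
  shows "0 \<le> char_inner G \<phi> \<psi>"
proof -
  obtain k \<alpha> where "1 \<le> k" and \<psi>: "\<psi> = (\<lambda>g. \<Sum>i<(k::nat). \<alpha> i g)"
    and \<alpha>: "\<forall>i<k. \<alpha> i \<in> monomial_characters G"
    using M_sums_cases[OF assms(4)] .
  show ?thesis
    unfolding \<psi> char_inner_sum
    using \<alpha> monomial_multiplicity_nonneg[OF G fin \<phi>] by (intro sum_nonneg) auto
qed

text \<open>Nonnegative multiplicities do not cancel: their sum is positive iff one of them is.\<close>

lemma constituents_add:
  assumes "group G" and "finite (carrier G)" and "\<psi> \<in> M_sums G" and "\<psi>' \<in> M_sums G"
  shows "constituents G (\<lambda>g. \<psi> g + \<psi>' g) = constituents G \<psi> \<union> constituents G \<psi>'"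
proof -
  have "char_inner G \<phi> (\<lambda>g. \<psi> g + \<psi>' g) = char_inner G \<phi> \<psi> + char_inner G \<phi> \<psi>'" for \<phi>
    by (simp add: char_inner_def sum.distrib add_divide_distrib algebra_simps)
  thus ?thesis
    using M_sums_multiplicity_nonneg[OF assms(1,2) _ assms(3)]
      M_sums_multiplicity_nonneg[OF assms(1,2) _ assms(4)]
    by (auto simp: constituents_def add_pos_nonneg add_nonneg_pos)
      (metis add.right_neutral order.not_eq_order_implies_strict)
qed

text \<open>If a sum of monomial characters has the constituent \<open>\<chi>\<close> but not \<open>\<phi>\<close>, then one summand has
  \<open>\<chi>\<close>, and no summand has \<open>\<phi>\<close>. So separation by sums is separation by monomial characters.\<close>

lemma separates_points_iff_monomial:
  assumes G: "group G" "finite (carrier G)"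
  shows "separates_points (Irr G) (constituents G ` M_sums G) \<longleftrightarrow>
    (\<forall>\<chi>\<in>Irr G. \<forall>\<phi>\<in>Irr G. \<chi> \<noteq> \<phi> \<longrightarrow>
      (\<exists>\<psi>\<in>monomial_characters G. \<chi> \<in> constituents G \<psi> \<and> \<phi> \<notin> constituents G \<psi>))"
proof -
  have summand: "\<exists>\<beta>\<in>monomial_characters G. \<chi> \<in> constituents G \<beta> \<and> \<phi> \<notin> constituents G \<beta>"
    if \<chi>: "\<chi> \<in> Irr G" and \<phi>: "\<phi> \<in> Irr G"
      and "\<psi> \<in> M_sums G" and in\<psi>: "\<chi> \<in> constituents G \<psi>" and notin\<psi>: "\<phi> \<notin> constituents G \<psi>" for \<chi> \<phi> \<psi>
  proof -
    obtain k \<alpha> where "1 \<le> k" and \<psi>: "\<psi> = (\<lambda>g. \<Sum>i<(k::nat). \<alpha> i g)"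
      and \<alpha>: "\<forall>i<k. \<alpha> i \<in> monomial_characters G"
      using M_sums_cases[OF \<open>\<psi> \<in> M_sums G\<close>] .
    have nonneg: "0 \<le> char_inner G \<phi> (\<alpha> i)" if "i < k" for i
      using monomial_multiplicity_nonneg[OF G \<phi> \<alpha>[rule_format, OF that]] .
    have "0 < (\<Sum>i<k. char_inner G \<chi> (\<alpha> i))"
      using in\<psi> by (simp add: \<psi> constituents_def char_inner_sum)
    then obtain i where i: "i < k" and "\<not> char_inner G \<chi> (\<alpha> i) \<le> 0"
      by (metis leD lessThan_iff sum_nonpos)
    hence "0 < char_inner G \<chi> (\<alpha> i)"
      using monomial_multiplicity_nonneg[OF G \<chi> \<alpha>[rule_format, OF i]] by (simp add: order.strict_iff_not)
    moreover have "\<not> 0 < char_inner G \<phi> (\<alpha> i)"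
      using notin\<psi> \<phi> sum_pos2[of "{..<k}" i "\<lambda>i. char_inner G \<phi> (\<alpha> i)"] i nonneg
      by (auto simp: \<psi> constituents_def char_inner_sum)
    ultimately show ?thesis using \<chi> \<alpha>[rule_format, OF i] by (auto simp: constituents_def)
  qed
  show ?thesis
    unfolding separates_points_def bex_simps(7)
  proof (intro ball_cong refl arg_cong2[of _ _ _ _ "(\<longrightarrow>)"] iffI; elim bexE conjE)
    fix \<chi> \<phi> \<psi>
    assume "\<chi> \<in> Irr G" "\<phi> \<in> Irr G" "\<psi> \<in> M_sums G"
      "\<chi> \<in> constituents G \<psi>" "\<phi> \<notin> constituents G \<psi>"
    thus "\<exists>\<beta>\<in>monomial_characters G. \<chi> \<in> constituents G \<beta> \<and> \<phi> \<notin> constituents G \<beta>"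
      by (rule summand)
  next
    fix \<chi> \<phi> \<psi>
    assume "\<psi> \<in> monomial_characters G" "\<chi> \<in> constituents G \<psi>" "\<phi> \<notin> constituents G \<psi>"
    thus "\<exists>\<psi>\<in>M_sums G. \<chi> \<in> constituents G \<psi> \<and> \<phi> \<notin> constituents G \<psi>"
      using monomial_characters_subset_M_sums by (intro bexI[of _ \<psi>] conjI) auto
  qed
qed

theorem theorem2p1:
  fixes G :: "('a, 'b) monoid_scheme" and r :: nat
  assumes "group G" and "finite (carrier G)"
    and "r = card (Irr G)" and "r \<noteq> 1"
  shows "(almost_monomial G \<longleftrightarrow> (\<exists>t. 1 \<le> t \<and> t \<le> r - 1 \<and> int (L_num t G) \<ge> N_num r t)) \<and>
         (almost_monomial G \<longleftrightarrow> L_num (r - 1) G = r)"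
proof -
  note G = assms(1,2)
  define F where "F = constituents G ` M_sums G"
  have fin: "finite (Irr G)" using finite_Irr[OF G] .
  have two: "2 \<le> card (Irr G)"
    using assms(3,4) fin Irr_nonempty[OF assms(1)] card_gt_0_iff[of "Irr G"] by linarith
  have F: "F \<subseteq> Pow (Irr G)" by (auto simp: F_def constituents_def)
  have union: "A \<union> B \<in> F" if "A \<in> F" "B \<in> F" for A B
  proof -
    from that obtain \<psi> \<psi>' where \<psi>: "\<psi> \<in> M_sums G" "A = constituents G \<psi>"
      and \<psi>': "\<psi>' \<in> M_sums G" "B = constituents G \<psi>'" by (auto simp: F_def)
    have "A \<union> B = constituents G (\<lambda>g. \<psi> g + \<psi>' g)"
      by (simp add: \<psi>(2) \<psi>'(2) constituents_add[OF G \<psi>(1) \<psi>'(1)])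
    thus ?thesis unfolding F_def using M_sums_add[OF \<psi>(1) \<psi>'(1)] by (rule image_eqI)
  qed
  have L: "L_num t G = card {A \<in> F. card A = t}" for t
    unfolding L_num_def F_def by (rule arg_cong[of _ _ card]) auto
  have "almost_monomial G \<longleftrightarrow> separates_points (Irr G) F"
    unfolding separates_points_iff_monomial[OF G, folded F_def] almost_monomial_def
      monomial_characters_def
    by (intro ball_cong refl arg_cong2[of _ _ _ _ "(\<longrightarrow>)"]) auto
  thus ?thesis
    using union_closed_separates_points_iff[OF fin two F union] by (simp add: L assms(3))
qed

end
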